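(* For every integer $n\ge1$, \[ CP_{(1,1)}(n,X,Y)=\prod_{i=1}^{n}\frac{1-X_{i-1}X_{i}Y_{i-1}Y_{i}}{(1-X_{i}Y_{i-1})(1-X_{i-1}Y_{i})(1-X_{i}Y_{i})}. \]
   Context: Let $x_1,x_2,\dots,y_1,y_2,\dots$ be formal variables, $X_i:=x_1\cdots x_i$, $Y_i:=y_1\cdots y_i$ for $i\ge1$, and $X_0=Y_0:=1$. For $n\ge1$, $CP_{(1,1)}(n,X,Y):=\sum \prod_{i=1}^n x_i^{a_i}y_i^{b_i}$, summed over all tuples of nonnegative integers $(a_1,\dots,a_n,b_1,\dots,b_n)$ with $a_1\ge\dots\ge a_n$, $b_1\ge\dots\ge b_n$, $a_j\ge b_{j+1}$ and $b_j\ge a_{j+1}$ for all $j\ge1$, where $a_j=b_j=0$ for $j>n$ (cylindric partitions with profile $(1,1)$ with at most $n$ nonzero entries in each row). *)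

theory Defs
  imports Complex_Main "HOL-Library.Poly_Mapping"
begin

text \<open>
  Formal power series with coefficients in \<open>'a\<close>, in commuting variables indexed by an arbitrary
  (possibly infinite) type \<open>'v\<close>: all functions from monomials to coefficients, where a
  monomial is a finitely supported exponent vector.
\<close>

typedef ('v, 'a) mfps = "UNIV :: (('v \<Rightarrow>\<^sub>0 nat) \<Rightarrow> 'a) set"
  morphisms mcoeff Abs_mfps by auto

setup_lifting type_definition_mfps

lemma mfps_eqI: "(\<And>m. mcoeff f m = mcoeff g m) \<Longrightarrow> f = g"
  by (simp add: mcoeff_inject[symmetric] fun_eq_iff)

definition splits :: "('v \<Rightarrow>\<^sub>0 nat) \<Rightarrow> (('v \<Rightarrow>\<^sub>0 nat) \<times> ('v \<Rightarrow>\<^sub>0 nat)) set" where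
  "splits m = {(i, j). i + j = m}"

lemma mem_splits [simp]: "(i, j) \<in> splits m \<longleftrightarrow> i + j = m"
  by (simp add: splits_def)

lemma finite_splits [simp]: "finite (splits m)"
proof -
  define K where "K = Poly_Mapping.keys m"
  define N where "N = (\<Sum>v\<in>K. Poly_Mapping.lookup m v)"
  let ?F = "{f :: 'a \<Rightarrow> nat. \<forall>v. (v \<in> K \<longrightarrow> f v \<in> {..N}) \<and> (v \<notin> K \<longrightarrow> f v = 0)}"
  have fin: "finite ?F"
    by (rule finite_set_of_finite_funs) (simp_all add: K_def)
  have bound: "Poly_Mapping.lookup i \<in> ?F" if "i + j = m" for i j
  proof -
    have le: "Poly_Mapping.lookup i v \<le> Poly_Mapping.lookup m v" for v
      using that by (auto simp: lookup_add)
    have "Poly_Mapping.lookup m v \<le> N" if "v \<in> K" for v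
      unfolding N_def by (rule member_le_sum) (use that in \<open>auto simp: K_def\<close>)
    moreover have "Poly_Mapping.lookup m v = 0" if "v \<notin> K" for v
      using that by (simp add: K_def in_keys_iff)
    ultimately show ?thesis
      using le by (auto intro: order_trans) (metis le_zero_eq)
  qed
  have "finite {i. Poly_Mapping.lookup i \<in> ?F}"
    using finite_vimageI[OF fin, of Poly_Mapping.lookup]
    by (simp add: vimage_def inj_def poly_mapping.lookup_inject)
  then have "finite ({i. Poly_Mapping.lookup i \<in> ?F} \<times> {i. Poly_Mapping.lookup i \<in> ?F})"
    by blast
  moreover have "splits m \<subseteq> {i. Poly_Mapping.lookup i \<in> ?F} \<times> {i. Poly_Mapping.lookup i \<in> ?F}"
  proof
    fix p assume "p \<in> splits m"
    then obtain i j where p: "p = (i, j)" "i + j = m" by (cases p) auto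
    have "j + i = m" using p by (simp add: add.commute)
    then show "p \<in> {i. Poly_Mapping.lookup i \<in> ?F} \<times> {i. Poly_Mapping.lookup i \<in> ?F}"
      using bound[of i j] bound[of j i] p by blast
  qed
  ultimately show ?thesis by (rule rev_finite_subset)
qed

instantiation mfps :: (type, comm_ring_1) comm_ring_1
begin

lift_definition zero_mfps :: "('a, 'b) mfps" is "\<lambda>m. 0" .
lift_definition one_mfps :: "('a, 'b) mfps" is "\<lambda>m. if m = 0 then 1 else 0" .
lift_definition plus_mfps :: "('a, 'b) mfps \<Rightarrow> ('a, 'b) mfps \<Rightarrow> ('a, 'b) mfps"
  is "\<lambda>f g m. f m + g m" .
lift_definition minus_mfps :: "('a, 'b) mfps \<Rightarrow> ('a, 'b) mfps \<Rightarrow> ('a, 'b) mfps"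
  is "\<lambda>f g m. f m - g m" .
lift_definition uminus_mfps :: "('a, 'b) mfps \<Rightarrow> ('a, 'b) mfps"
  is "\<lambda>f m. - f m" .
lift_definition times_mfps :: "('a, 'b) mfps \<Rightarrow> ('a, 'b) mfps \<Rightarrow> ('a, 'b) mfps"
  is "\<lambda>f g m. \<Sum>(i, j)\<in>splits m. f i * g j" .

instance
proof
  fix a b c :: "('a, 'b) mfps"
  show "a * b * c = a * (b * c)"
  proof (rule mfps_eqI)
    fix m
    let ?a = "mcoeff a" and ?b = "mcoeff b" and ?c = "mcoeff c"
    have "mcoeff (a * b * c) m =
        (\<Sum>p\<in>splits m. \<Sum>q\<in>splits (fst p). ?a (fst q) * ?b (snd q) * ?c (snd p))"
      by (simp add: times_mfps.rep_eq case_prod_unfold sum_distrib_right)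
    also have "\<dots> = (\<Sum>(p, q)\<in>(SIGMA p:splits m. splits (fst p)).
        ?a (fst q) * ?b (snd q) * ?c (snd p))"
      by (rule sum.Sigma) auto
    also have "\<dots> = (\<Sum>(p, q)\<in>(SIGMA p:splits m. splits (snd p)).
        ?a (fst p) * (?b (fst q) * ?c (snd q)))"
      by (rule sum.reindex_bij_witness[where
            i = "\<lambda>(p, q). ((fst p + fst q, snd q), (fst p, fst q))" and
            j = "\<lambda>(p, q). ((fst q, snd q + snd p), (snd q, snd p))"])
         (auto simp: mult.assoc add.assoc)
    also have "\<dots> = (\<Sum>p\<in>splits m. \<Sum>q\<in>splits (snd p).
        ?a (fst p) * (?b (fst q) * ?c (snd q)))"
      by (rule sum.Sigma[symmetric]) auto
    also have "\<dots> = mcoeff (a * (b * c)) m"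
      by (simp add: times_mfps.rep_eq case_prod_unfold sum_distrib_left)
    finally show "mcoeff (a * b * c) m = mcoeff (a * (b * c)) m" .
  qed
  show "a * b = b * a"
  proof (rule mfps_eqI)
    fix m
    show "mcoeff (a * b) m = mcoeff (b * a) m"
      unfolding times_mfps.rep_eq
      by (rule sum.reindex_bij_witness[where i = prod.swap and j = prod.swap])
         (auto simp: mult.commute add.commute)
  qed
  show "1 * a = a"
  proof (rule mfps_eqI)
    fix m
    have "mcoeff (1 * a) m = (\<Sum>p\<in>{(0 :: 'a \<Rightarrow>\<^sub>0 nat, m)}. mcoeff a (snd p))"
      unfolding times_mfps.rep_eq
      by (rule sum.mono_neutral_cong_right[OF finite_splits]) (auto simp: one_mfps.rep_eq split: if_splits)
    then show "mcoeff (1 * a) m = mcoeff a m" by simp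
  qed
  show "(a + b) * c = a * c + b * c"
    by (rule mfps_eqI)
       (simp add: times_mfps.rep_eq plus_mfps.rep_eq case_prod_unfold distrib_right sum.distrib)
  show "(0 :: ('a, 'b) mfps) \<noteq> 1"
    by (metis one_mfps.rep_eq zero_mfps.rep_eq zero_neq_one)
qed (rule mfps_eqI;
     simp add: plus_mfps.rep_eq minus_mfps.rep_eq uminus_mfps.rep_eq zero_mfps.rep_eq)+

end

text \<open>
  The inverse of a unit of the ring, with value 0 at non-units; \<open>1 - f\<close> is a unit whenever
  \<open>f\<close> has zero constant term (lemma \<open>mfps_one_minus_inverse\<close> below).
\<close>

instantiation mfps :: (type, comm_ring_1) inverse
begin

definition inverse_mfps :: "('a, 'b) mfps \<Rightarrow> ('a, 'b) mfps" where
  "inverse_mfps f = (if f dvd 1 then (THE g. f * g = 1) else 0)"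

definition divide_mfps :: "('a, 'b) mfps \<Rightarrow> ('a, 'b) mfps \<Rightarrow> ('a, 'b) mfps" where
  "divide_mfps f g = f * inverse g"

instance ..

end

lemma mfps_inverse_unique:
  fixes f g :: "('v, 'a::comm_ring_1) mfps"
  assumes "f * g = 1"
  shows "inverse f = g"
proof -
  have "h = g" if "f * h = 1" for h
  proof -
    have "h = (f * g) * h" using assms by simp
    also have "\<dots> = (f * h) * g" by (simp add: mult_ac)
    finally show ?thesis using that by simp
  qed
  then have "(THE g. f * g = 1) = g" using assms by blast
  moreover have "f dvd 1" using assms by (metis dvdI)
  ultimately show ?thesis by (simp add: inverse_mfps_def)
qed

definition mdeg :: "('v \<Rightarrow>\<^sub>0 nat) \<Rightarrow> nat" where
  "mdeg m = (\<Sum>v\<in>Poly_Mapping.keys m. Poly_Mapping.lookup m v)"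

lemma mdeg_add: "mdeg (i + j) = mdeg i + mdeg j"
proof -
  let ?K = "Poly_Mapping.keys i \<union> Poly_Mapping.keys j"
  have *: "mdeg m = (\<Sum>v\<in>?K. Poly_Mapping.lookup m v)" if "Poly_Mapping.keys m \<subseteq> ?K" for m
    unfolding mdeg_def
    by (rule sum.mono_neutral_left) (use that in \<open>auto simp: in_keys_iff\<close>)
  show ?thesis
    using *[of "i + j"] *[of i] *[of j] keys_add[of i j]
    by (simp add: lookup_add sum.distrib)
qed

lemma mdeg_eq_0_iff: "mdeg m = 0 \<longleftrightarrow> m = 0"
proof -
  have "mdeg m = 0 \<longleftrightarrow> (\<forall>v. Poly_Mapping.lookup m v = 0)"
    by (auto simp: mdeg_def in_keys_iff)
  also have "\<dots> \<longleftrightarrow> m = 0"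
    by (auto intro: poly_mapping_eqI)
  finally show ?thesis .
qed

lemma mcoeff_power_eq_0:
  fixes f :: "('v, 'a::comm_ring_1) mfps"
  assumes "mcoeff f 0 = 0" "mdeg m < k"
  shows "mcoeff (f ^ k) m = 0"
  using assms(2)
proof (induction k arbitrary: m)
  case (Suc k)
  have "mcoeff f i * mcoeff (f ^ k) j = 0" if "i + j = m" for i j
  proof (cases "i = 0")
    case False
    then have "mdeg j < k"
      using Suc.prems that mdeg_add[of i j] mdeg_eq_0_iff[of i] by simp
    then show ?thesis using Suc.IH by simp
  qed (simp add: assms)
  then show ?case
    by (auto simp: times_mfps.rep_eq intro!: sum.neutral)
qed simp

lemma mcoeff_sum: "mcoeff (\<Sum>k\<in>A. f k) m = (\<Sum>k\<in>A. mcoeff (f k) m)"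
  by (induction A rule: infinite_finite_induct)
     (simp_all add: plus_mfps.rep_eq zero_mfps.rep_eq)

lemma mfps_one_minus_inverse:
  fixes f :: "('v, 'a::comm_ring_1) mfps"
  assumes f0: "mcoeff f 0 = 0"
  shows "(1 - f) * inverse (1 - f) = 1"
proof -
  define g where "g = Abs_mfps (\<lambda>m. \<Sum>k\<le>mdeg m. mcoeff (f ^ k) m)"
  have cg: "mcoeff g m = (\<Sum>k\<le>mdeg m. mcoeff (f ^ k) m)" for m
    by (simp add: g_def Abs_mfps_inverse)
  have trunc: "mcoeff g m = mcoeff (\<Sum>k\<le>N. f ^ k) m" if "mdeg m \<le> N" for m N
    unfolding cg mcoeff_sum
    by (rule sum.mono_neutral_left) (use that in \<open>auto intro: mcoeff_power_eq_0[OF f0]\<close>)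
  have "(1 - f) * g = 1"
  proof (rule mfps_eqI)
    fix m
    have "mcoeff ((1 - f) * g) m = mcoeff ((1 - f) * (\<Sum>k\<le>mdeg m. f ^ k)) m"
      unfolding times_mfps.rep_eq
      by (rule sum.cong) (auto simp: mdeg_add intro!: arg_cong2[where f = "(*)"] trunc)
    also have "(1 - f) * (\<Sum>k\<le>mdeg m. f ^ k) = 1 - f ^ Suc (mdeg m)"
      by (metis one_diff_power_eq lessThan_Suc_atMost)
    also have "mcoeff \<dots> m = mcoeff 1 m"
      by (simp only: minus_mfps.rep_eq mcoeff_power_eq_0[OF f0 lessI] diff_0_right)
    finally show "mcoeff ((1 - f) * g) m = mcoeff 1 m" .
  qed
  then show ?thesis by (metis mfps_inverse_unique)
qed

lift_definition mvar :: "'v \<Rightarrow> ('v, 'a::comm_ring_1) mfps" is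
  "\<lambda>v m. if m = Poly_Mapping.single v 1 then 1 else 0" .

text \<open>
  Coefficientwise sum of a possibly infinite family; it is meaningful when every monomial occurs
  in only finitely many members of the family (a coefficient for which this fails is 0).
\<close>

definition formal_sum :: "('i \<Rightarrow> ('v, 'a::comm_ring_1) mfps) \<Rightarrow> 'i set \<Rightarrow> ('v, 'a) mfps" where
  "formal_sum f I = Abs_mfps (\<lambda>m. \<Sum>i\<in>{i \<in> I. mcoeff (f i) m \<noteq> 0}. mcoeff (f i) m)"

datatype xy_var = XVar nat | YVar nat

abbreviation xvar :: "nat \<Rightarrow> (xy_var, 'a::comm_ring_1) mfps" where
  "xvar i \<equiv> mvar (XVar i)"

abbreviation yvar :: "nat \<Rightarrow> (xy_var, 'a::comm_ring_1) mfps" where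
  "yvar i \<equiv> mvar (YVar i)"

definition Xprod :: "nat \<Rightarrow> (xy_var, 'a::comm_ring_1) mfps" where
  "Xprod i = (\<Prod>j=1..i. xvar j)"

definition Yprod :: "nat \<Rightarrow> (xy_var, 'a::comm_ring_1) mfps" where
  "Yprod i = (\<Prod>j=1..i. yvar j)"

text \<open>
  A tuple \<open>(a\<^sub>1, \<dots>, a\<^sub>n)\<close> is represented by the function \<open>a\<close> that is zero at all indices
  \<open>j > n\<close> and at the unused index \<open>0\<close>, so that distinct tuples are distinct functions.
\<close>

definition cylindric_partitions_11 :: "nat \<Rightarrow> ((nat \<Rightarrow> nat) \<times> (nat \<Rightarrow> nat)) set" where
  "cylindric_partitions_11 n = {(a, b).
     (\<forall>j. j = 0 \<or> j > n \<longrightarrow> a j = 0 \<and> b j = 0) \<and>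
     (\<forall>j\<ge>1. a j \<ge> a (j + 1) \<and> b j \<ge> b (j + 1) \<and> a j \<ge> b (j + 1) \<and> b j \<ge> a (j + 1))}"

definition CP_11 :: "nat \<Rightarrow> (xy_var, 'a::comm_ring_1) mfps" where
  "CP_11 n = formal_sum (\<lambda>(a, b). \<Prod>i=1..n. xvar i ^ a i * yvar i ^ b i) (cylindric_partitions_11 n)"

definition mmonom :: "('v \<Rightarrow>\<^sub>0 nat) \<Rightarrow> ('v, 'a::comm_ring_1) mfps" where
  "mmonom e = Abs_mfps (\<lambda>m. if m = e then 1 else 0)"

lemma mcoeff_mmonom: "mcoeff (mmonom e) m = (if m = e then 1 else 0)"
  by (simp add: mmonom_def Abs_mfps_inverse)

lemma mmonom_0: "mmonom 0 = 1"
  by (rule mfps_eqI) (simp add: mcoeff_mmonom one_mfps.rep_eq)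

lemma mmonom_mult: "mmonom d * mmonom e = mmonom (d + e)"
proof (rule mfps_eqI)
  fix m
  have "mcoeff (mmonom d * mmonom e) m =
      (\<Sum>p\<in>splits m. if p = (d, e) then 1 else 0 :: 'b)"
    unfolding times_mfps.rep_eq by (rule sum.cong) (auto simp: mcoeff_mmonom split: if_splits)
  also have "\<dots> = mcoeff (mmonom (d + e)) m"
    by (auto simp: mcoeff_mmonom)
  finally show "mcoeff (mmonom d * mmonom e :: ('a, 'b) mfps) m = mcoeff (mmonom (d + e)) m" .
qed

lemma mvar_eq_mmonom: "mvar v = mmonom (Poly_Mapping.single v 1)"
  by (rule mfps_eqI) (simp add: mvar.rep_eq mcoeff_mmonom)

lemma mvar_power: "mvar v ^ k = mmonom (Poly_Mapping.single v k)"
  by (induction k) (simp_all add: mmonom_0 mvar_eq_mmonom mmonom_mult flip: single_add)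

lemma mmonom_sum: "(\<Prod>i\<in>A. mmonom (e i)) = mmonom (\<Sum>i\<in>A. e i)"
  by (induction A rule: infinite_finite_induct) (simp_all add: mmonom_0 mmonom_mult)

lemma xy_monomial:
  "(\<Prod>i=1..n. xvar i ^ a i * yvar i ^ b i) = mmonom (\<Sum>i=1..n.
     Poly_Mapping.single (XVar i) (a i) + Poly_Mapping.single (YVar i) (b i))"
  by (simp add: mvar_power mmonom_mult mmonom_sum)

lemma CP_11_locally_finite:
  "finite {p \<in> cylindric_partitions_11 n.
     mcoeff ((case p of (a, b) \<Rightarrow> \<Prod>i=1..n. xvar i ^ a i * yvar i ^ b i) :: (xy_var, 'a::comm_ring_1) mfps) m \<noteq> 0}"
    (is "finite ?S")
proof -
  let ?a = "\<lambda>i. if i \<in> {1..n} then Poly_Mapping.lookup m (XVar i) else 0"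
  let ?b = "\<lambda>i. if i \<in> {1..n} then Poly_Mapping.lookup m (YVar i) else 0"
  have "?S \<subseteq> {(?a, ?b)}"
  proof
    fix p assume p: "p \<in> ?S"
    obtain a b where ab: "p = (a, b)" by (cases p)
    have m: "m = (\<Sum>i=1..n. Poly_Mapping.single (XVar i) (a i) + Poly_Mapping.single (YVar i) (b i))"
      using p unfolding ab by (simp add: xy_monomial[simplified] mcoeff_mmonom split: if_splits)
    have "a i = ?a i" "b i = ?b i" for i
      using p unfolding ab m
      by (auto simp: cylindric_partitions_11_def lookup_sum lookup_add lookup_single when_def not_less_eq_eq)
    then show "p \<in> {(?a, ?b)}" unfolding ab by blast
  qed
  then show ?thesis by (rule finite_subset) simp
qed

end

theory Submission
  imports Defs
begin

text \<open>
  The monomials of \<open>CP\<^sub>n\<close> have coefficient one, so \<open>CP\<^sub>n\<close> is the indicator series of the set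
  of its exponent vectors. Put \<open>w = X\<^sub>n Y\<^sub>n\<close>, \<open>u = X\<^sub>n Y\<^bsub>n-1\<^esub>\<close>, \<open>v = X\<^bsub>n-1\<^esub> Y\<^sub>n\<close>. Multiplication
  by \<open>w\<close> adds one to every entry, so \<open>(1 - w) CP\<^sub>n\<close> enumerates the partitions with \<open>a\<^sub>n = 0\<close>
  or \<open>b\<^sub>n = 0\<close>. Those with \<open>b\<^sub>n = 0\<close> are enumerated by \<open>CP\<^bsub>n-1\<^esub> / (1 - u)\<close>, those with \<open>a\<^sub>n = 0\<close>
  by \<open>CP\<^bsub>n-1\<^esub> / (1 - v)\<close>, and those with both by \<open>CP\<^bsub>n-1\<^esub>\<close>. The theorem follows from
  \<open>1 / (1 - u) + 1 / (1 - v) - 1 = (1 - u v) / ((1 - u) (1 - v))\<close>.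
\<close>

section \<open>Indicator series and multiplication by a monomial\<close>

definition indicator_mfps :: "('v \<Rightarrow>\<^sub>0 nat) set \<Rightarrow> ('v, 'a::comm_ring_1) mfps" where
  "indicator_mfps A = Abs_mfps (\<lambda>m. if m \<in> A then 1 else 0)"

lemma mcoeff_indicator_mfps: "mcoeff (indicator_mfps A) m = (if m \<in> A then 1 else 0)"
  by (simp add: indicator_mfps_def Abs_mfps_inverse)

lemma indicator_mfps_Un:
  "indicator_mfps (A \<union> B) = indicator_mfps A + indicator_mfps B - indicator_mfps (A \<inter> B)"
  by (rule mfps_eqI) (simp add: mcoeff_indicator_mfps plus_mfps.rep_eq minus_mfps.rep_eq)

lemma mmonom_mult_indicator_mfps:
  "mmonom d * indicator_mfps A = (indicator_mfps ((+) d ` A) :: ('v, 'a::comm_ring_1) mfps)"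
proof (rule mfps_eqI)
  fix m
  have "mcoeff (mmonom d * indicator_mfps A :: ('v, 'a) mfps) m =
      (\<Sum>p\<in>splits m. if p \<in> {d} \<times> A then 1 else 0)"
    unfolding times_mfps.rep_eq
    by (rule sum.cong) (auto simp: mcoeff_mmonom mcoeff_indicator_mfps split: if_splits)
  also have "\<dots> = (\<Sum>p\<in>splits m \<inter> {d} \<times> A. 1)"
    by (rule sum.inter_restrict[symmetric]) simp
  \<comment> \<open>By cancellation, \<open>(d, m - d)\<close> is the only splitting that can
    contribute.\<close>
  also have "splits m \<inter> {d} \<times> A = (if m \<in> (+) d ` A then {(d, m - d)} else {})"
    by auto
  also have "(\<Sum>p\<in>\<dots>. 1) = mcoeff (indicator_mfps ((+) d ` A) :: ('v, 'a) mfps) m"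
    by (simp add: mcoeff_indicator_mfps)
  finally show "mcoeff (mmonom d * indicator_mfps A :: ('v, 'a) mfps) m = \<dots>" .
qed

text \<open>Multiplication by \<open>mmonom d\<close> translates \<open>A\<close> by
  \<open>d\<close>. If the translate is the part of \<open>A\<close> cut out by \<open>P\<close>,
  subtracting it leaves the rest of \<open>A\<close>.\<close>

lemma one_minus_mmonom_mult_indicator_mfps:
  assumes "\<And>m. m \<in> (+) d ` A \<longleftrightarrow> m \<in> A \<and> P m"
  shows "(1 - mmonom d) * indicator_mfps A =
    (indicator_mfps {m \<in> A. \<not> P m} :: ('v, 'a::comm_ring_1) mfps)"
  by (rule mfps_eqI)
    (use assms in \<open>simp add: left_diff_distrib mmonom_mult_indicator_mfps
      mcoeff_indicator_mfps minus_mfps.rep_eq\<close>)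

text \<open>Subtraction of exponents is truncated, so \<open>m - d\<close> is a genuine preimage
  only under the componentwise bound.\<close>

lemma mem_image_plus_iff:
  fixes d m :: "'v \<Rightarrow>\<^sub>0 nat"
  shows "m \<in> (+) d ` A \<longleftrightarrow> (\<forall>v. Poly_Mapping.lookup d v \<le> Poly_Mapping.lookup m v) \<and> m - d \<in> A"
proof
  assume "m \<in> (+) d ` A"
  then show "(\<forall>v. Poly_Mapping.lookup d v \<le> Poly_Mapping.lookup m v) \<and> m - d \<in> A"
    by (auto simp: lookup_add)
next
  assume *: "(\<forall>v. Poly_Mapping.lookup d v \<le> Poly_Mapping.lookup m v) \<and> m - d \<in> A"
  then have "m = d + (m - d)"
    by (intro poly_mapping_eqI) (simp add: lookup_add lookup_minus)
  with * show "m \<in> (+) d ` A"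
    by blast
qed

section \<open>Exponent vectors of cylindric partitions\<close>

abbreviation xexp :: "(xy_var \<Rightarrow>\<^sub>0 nat) \<Rightarrow> nat \<Rightarrow> nat" where
  "xexp m i \<equiv> Poly_Mapping.lookup m (XVar i)"

abbreviation yexp :: "(xy_var \<Rightarrow>\<^sub>0 nat) \<Rightarrow> nat \<Rightarrow> nat" where
  "yexp m i \<equiv> Poly_Mapping.lookup m (YVar i)"

lemma all_xy_var: "(\<forall>v. P v) \<longleftrightarrow> (\<forall>k. P (XVar k)) \<and> (\<forall>k. P (YVar k))"
  by (metis xy_var.exhaust)

lemma xy_exponent_eq_iff: "m = m' \<longleftrightarrow> (\<forall>i. xexp m i = xexp m' i) \<and> (\<forall>i. yexp m i = yexp m' i)"
  by (simp add: poly_mapping_eq_iff fun_eq_iff all_xy_var)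

definition cp_exponents :: "nat \<Rightarrow> (xy_var \<Rightarrow>\<^sub>0 nat) set" where
  "cp_exponents n =
     {m. (\<lambda>i. xexp m i, \<lambda>i. yexp m i) \<in> cylindric_partitions_11 n}"

lemma cp_exponents_iff:
  "m \<in> cp_exponents n \<longleftrightarrow>
     (\<forall>j. j = 0 \<or> j > n \<longrightarrow> xexp m j = 0 \<and> yexp m j = 0) \<and>
     (\<forall>j. 1 \<le> j \<and> j < n \<longrightarrow>
        xexp m (Suc j) \<le> xexp m j \<and> yexp m (Suc j) \<le> yexp m j \<and>
        yexp m (Suc j) \<le> xexp m j \<and> xexp m (Suc j) \<le> yexp m j)"
  unfolding cp_exponents_def cylindric_partitions_11_def
  by (auto simp: not_less) (metis le_0_eq less_Suc_eq_le not_less zero_le)+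

text \<open>An exponent vector determines its pair of rows, so at most one partition contributes to
  each coefficient.\<close>

lemma CP_11_eq_indicator_mfps:
  "(CP_11 n :: (xy_var, 'a::comm_ring_1) mfps) = indicator_mfps (cp_exponents n)"
proof (rule mfps_eqI)
  fix m
  let ?mono = "\<lambda>(a, b). \<Prod>i=1..n. xvar i ^ a i * yvar i ^ b i :: (xy_var, 'a) mfps"
  define p where "p = (\<lambda>i. xexp m i, \<lambda>i. yexp m i)"
  \<comment> \<open>Membership of \<open>q\<close> makes both rows vanish outside 1..n, so the
    exponent vector recovers them at every index.\<close>
  have mono: "mcoeff (?mono q) m = (if p = q then 1 else 0)" if "q \<in> cylindric_partitions_11 n" for q
  proof (cases q)
    case (Pair a b)
    let ?e = "\<Sum>i=1..n. Poly_Mapping.single (XVar i) (a i) + Poly_Mapping.single (YVar i) (b i)"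
    have "xexp ?e i = a i" "yexp ?e i = b i" for i
      using that Pair
      by (auto simp: cylindric_partitions_11_def lookup_sum lookup_add lookup_single when_def
            not_less_eq_eq)
    then have "m = ?e \<longleftrightarrow> p = q"
      by (simp add: xy_exponent_eq_iff p_def Pair fun_eq_iff)
    then show ?thesis
      unfolding Pair prod.case xy_monomial mcoeff_mmonom by simp
  qed
  then have "{q \<in> cylindric_partitions_11 n. mcoeff (?mono q) m \<noteq> 0} =
      (if p \<in> cylindric_partitions_11 n then {p} else {})"
    by (auto split: if_splits)
  then show "mcoeff (CP_11 n :: (xy_var, 'a) mfps) m = mcoeff (indicator_mfps (cp_exponents n)) m"
    using mono[of p] unfolding CP_11_def formal_sum_def
    by (simp add: Abs_mfps_inverse mcoeff_indicator_mfps cp_exponents_def flip: p_def)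
qed

text \<open>The inequalities also cross between the rows, so either last entry is a lower bound for
  all earlier entries of both rows. One positive last entry thus allows 1 to be subtracted from all
  earlier entries.\<close>

lemma cp_exponents_last_le:
  assumes "m \<in> cp_exponents n" "1 \<le> j" "j < n"
  shows "xexp m n \<le> xexp m j" "xexp m n \<le> yexp m j"
    "yexp m n \<le> xexp m j" "yexp m n \<le> yexp m j"
proof -
  from assms(3,2) have "xexp m n \<le> xexp m j \<and> xexp m n \<le> yexp m j
    \<and> yexp m n \<le> xexp m j \<and> yexp m n \<le> yexp m j"
  proof (induction rule: strict_inc_induct)
    case (base i)
    then show ?case using assms(1) by (auto simp: cp_exponents_iff)
  next
    case (step i)
    then have "xexp m (Suc i) \<le> xexp m i" "xexp m (Suc i) \<le> yexp m i"
      using assms(1) by (auto simp: cp_exponents_iff)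
    with step show ?case by (meson le_SucI order_trans)
  qed
  then show "xexp m n \<le> xexp m j" "xexp m n \<le> yexp m j"
    "yexp m n \<le> xexp m j" "yexp m n \<le> yexp m j"
    by auto
qed

section \<open>Shifts by X_i Y_j and the recursion for CP\<close>

definition XY_exponent :: "nat \<Rightarrow> nat \<Rightarrow> (xy_var \<Rightarrow>\<^sub>0 nat)" where
  "XY_exponent i j =
     (\<Sum>k=1..i. Poly_Mapping.single (XVar k) 1) + (\<Sum>k=1..j. Poly_Mapping.single (YVar k) 1)"

lemma lookup_XY_exponent [simp]:
  "xexp (XY_exponent i j) k = (if 1 \<le> k \<and> k \<le> i then 1 else 0)"
  "yexp (XY_exponent i j) k = (if 1 \<le> k \<and> k \<le> j then 1 else 0)"
  by (simp_all add: XY_exponent_def lookup_add lookup_sum lookup_single when_def)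

lemma Xprod_mult_Yprod: "Xprod i * Yprod j = mmonom (XY_exponent i j)"
  by (simp only: Xprod_def Yprod_def XY_exponent_def mvar_eq_mmonom mmonom_sum mmonom_mult)

text \<open>Once both entries at n + 1 vanish, the inequalities at j = n are trivial.\<close>

lemma cp_exponents_eq_last_zero:
  "cp_exponents n = {m \<in> cp_exponents (Suc n). xexp m (Suc n) = 0 \<and> yexp m (Suc n) = 0}"
  by (auto simp: cp_exponents_iff less_Suc_eq) (metis Suc_lessI)+

text \<open>Adding one to every entry preserves all inequalities. It can be undone when both last
  entries are positive, because the smaller of them is the minimum of all entries.\<close>

lemma one_minus_XY_mult_CP_11:
  "(1 - Xprod (Suc n) * Yprod (Suc n)) * CP_11 (Suc n) =
    (indicator_mfps ({m \<in> cp_exponents (Suc n). xexp m (Suc n) = 0} \<union>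
       {m \<in> cp_exponents (Suc n). yexp m (Suc n) = 0}) :: (xy_var, 'a::comm_ring_1) mfps)"
proof -
  let ?d = "XY_exponent (Suc n) (Suc n)" and ?A = "cp_exponents (Suc n)"
  have "m \<in> (+) ?d ` ?A \<longleftrightarrow> m \<in> ?A \<and> 0 < xexp m (Suc n) \<and> 0 < yexp m (Suc n)" for m
  proof
    assume "m \<in> (+) ?d ` ?A"
    then show "m \<in> ?A \<and> 0 < xexp m (Suc n) \<and> 0 < yexp m (Suc n)"
      by (auto simp: cp_exponents_iff lookup_add less_Suc_eq)
  next
    assume *: "m \<in> ?A \<and> 0 < xexp m (Suc n) \<and> 0 < yexp m (Suc n)"
    have "1 \<le> xexp m j \<and> 1 \<le> yexp m j" if "1 \<le> j" "j \<le> n" for j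
      using * cp_exponents_last_le[of m "Suc n" j] that by auto
    with * show "m \<in> (+) ?d ` ?A"
      by (auto simp: mem_image_plus_iff all_xy_var cp_exponents_iff lookup_minus le_Suc_eq
            less_Suc_eq diff_le_mono)
  qed
  note one_minus_mmonom_mult_indicator_mfps[OF this]
  also have "{m \<in> ?A. \<not> (0 < xexp m (Suc n) \<and> 0 < yexp m (Suc n))} =
      {m \<in> cp_exponents (Suc n). xexp m (Suc n) = 0} \<union>
      {m \<in> cp_exponents (Suc n). yexp m (Suc n) = 0}"
    by auto
  finally show ?thesis
    by (simp add: Xprod_mult_Yprod CP_11_eq_indicator_mfps)
qed

text \<open>With the last y-entry fixed at zero, the shift raises every other entry by one. It can
  be undone exactly when the last x-entry is positive; what remains has both last entries
  zero.\<close>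

lemma one_minus_X_mult_indicator_mfps:
  "(1 - Xprod (Suc n) * Yprod n) *
     indicator_mfps {m \<in> cp_exponents (Suc n). yexp m (Suc n) = 0} =
    (CP_11 n :: (xy_var, 'a::comm_ring_1) mfps)"
proof -
  let ?d = "XY_exponent (Suc n) n" and ?A = "{m \<in> cp_exponents (Suc n). yexp m (Suc n) = 0}"
  have "m \<in> (+) ?d ` ?A \<longleftrightarrow> m \<in> ?A \<and> 0 < xexp m (Suc n)" for m
  proof
    assume "m \<in> (+) ?d ` ?A"
    then show "m \<in> ?A \<and> 0 < xexp m (Suc n)"
      by (auto simp: cp_exponents_iff lookup_add less_Suc_eq)
  next
    assume *: "m \<in> ?A \<and> 0 < xexp m (Suc n)"
    have "1 \<le> xexp m j \<and> 1 \<le> yexp m j" if "1 \<le> j" "j \<le> n" for j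
      using * cp_exponents_last_le[of m "Suc n" j] that by auto
    \<comment> \<open>This settles the boundary inequality at j = n: its larger side drops by one
      while y at n + 1 is unchanged, which is harmless because that entry is zero.\<close>
    moreover have "yexp m (Suc j) = 0" if "\<not> Suc j \<le> n" "j \<le> n" for j
    proof -
      from that have "j = n" by simp
      with * show ?thesis by simp
    qed
    ultimately show "m \<in> (+) ?d ` ?A"
      using * by (auto simp: mem_image_plus_iff all_xy_var cp_exponents_iff lookup_minus le_Suc_eq
            less_Suc_eq diff_le_mono)
  qed
  note one_minus_mmonom_mult_indicator_mfps[OF this]
  also have "{m \<in> ?A. \<not> 0 < xexp m (Suc n)} = cp_exponents n"
    by (auto simp: cp_exponents_eq_last_zero[of n])
  finally show ?thesis
    by (simp add: Xprod_mult_Yprod CP_11_eq_indicator_mfps)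
qed

text \<open>Mirror image of \<open>one_minus_X_mult_indicator_mfps\<close> under exchange of the
  rows.\<close>

lemma one_minus_Y_mult_indicator_mfps:
  "(1 - Xprod n * Yprod (Suc n)) *
     indicator_mfps {m \<in> cp_exponents (Suc n). xexp m (Suc n) = 0} =
    (CP_11 n :: (xy_var, 'a::comm_ring_1) mfps)"
proof -
  let ?d = "XY_exponent n (Suc n)" and ?A = "{m \<in> cp_exponents (Suc n). xexp m (Suc n) = 0}"
  have "m \<in> (+) ?d ` ?A \<longleftrightarrow> m \<in> ?A \<and> 0 < yexp m (Suc n)" for m
  proof
    assume "m \<in> (+) ?d ` ?A"
    then show "m \<in> ?A \<and> 0 < yexp m (Suc n)"
      by (auto simp: cp_exponents_iff lookup_add less_Suc_eq)
  next
    assume *: "m \<in> ?A \<and> 0 < yexp m (Suc n)"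
    have "1 \<le> xexp m j \<and> 1 \<le> yexp m j" if "1 \<le> j" "j \<le> n" for j
      using * cp_exponents_last_le[of m "Suc n" j] that by auto
    moreover have "xexp m (Suc j) = 0" if "\<not> Suc j \<le> n" "j \<le> n" for j
    proof -
      from that have "j = n" by simp
      with * show ?thesis by simp
    qed
    ultimately show "m \<in> (+) ?d ` ?A"
      using * by (auto simp: mem_image_plus_iff all_xy_var cp_exponents_iff lookup_minus le_Suc_eq
            less_Suc_eq diff_le_mono)
  qed
  note one_minus_mmonom_mult_indicator_mfps[OF this]
  also have "{m \<in> ?A. \<not> 0 < yexp m (Suc n)} = cp_exponents n"
    by (auto simp: cp_exponents_eq_last_zero[of n])
  finally show ?thesis
    by (simp add: Xprod_mult_Yprod CP_11_eq_indicator_mfps)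
qed

text \<open>Clearing denominators reduces inclusion-exclusion to the ring identity (1 - u) + (1 - v)
  - (1 - u)(1 - v) = 1 - u v.\<close>

lemma CP_11_Suc_mult:
  fixes n :: nat and u v :: "(xy_var, 'a::comm_ring_1) mfps"
  defines "u \<equiv> Xprod (Suc n) * Yprod n" and "v \<equiv> Xprod n * Yprod (Suc n)"
  shows "(1 - u) * (1 - v) * (1 - Xprod (Suc n) * Yprod (Suc n)) * CP_11 (Suc n) =
    (1 - u * v) * CP_11 n"
proof -
  let ?A = "{m \<in> cp_exponents (Suc n). xexp m (Suc n) = 0}"
  let ?B = "{m \<in> cp_exponents (Suc n). yexp m (Suc n) = 0}"
  let ?C = "CP_11 n :: (xy_var, 'a) mfps"
  have "?A \<inter> ?B = cp_exponents n"
    by (auto simp: cp_exponents_eq_last_zero[of n])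
  then have "(1 - Xprod (Suc n) * Yprod (Suc n)) * CP_11 (Suc n) =
      indicator_mfps ?A + indicator_mfps ?B - ?C"
    by (simp only: one_minus_XY_mult_CP_11 indicator_mfps_Un CP_11_eq_indicator_mfps[of n])
  then have "(1 - u) * (1 - v) * (1 - Xprod (Suc n) * Yprod (Suc n)) * CP_11 (Suc n) =
      (1 - u) * (1 - v) * (indicator_mfps ?A + indicator_mfps ?B - ?C)"
    by (simp add: mult.assoc)
  \<comment> \<open>Each indicator is grouped with the factor that turns it into
    \<open>CP_11 n\<close>.\<close>
  also have "\<dots> = (1 - u) * ((1 - v) * indicator_mfps ?A) +
      (1 - v) * ((1 - u) * indicator_mfps ?B) - (1 - u) * (1 - v) * ?C"
    by (simp add: algebra_simps)
  also have "\<dots> = (1 - u) * ?C + (1 - v) * ?C - (1 - u) * (1 - v) * ?C"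
    by (simp only: u_def v_def one_minus_X_mult_indicator_mfps one_minus_Y_mult_indicator_mfps)
  also have "\<dots> = (1 - u * v) * ?C"
    by (simp add: algebra_simps)
  finally show ?thesis .
qed

section \<open>Units, division and the product formula\<close>

lemma mfps_eq_divideI:
  fixes f g h :: "('v, 'a::comm_ring_1) mfps"
  assumes "g * f = h" "g dvd 1"
  shows "f = h / g"
proof -
  from assms(2) obtain k where "g * k = 1" by (metis dvdE)
  with mfps_inverse_unique[OF this] assms(1) show ?thesis
    by (metis divide_mfps_def mult.commute mult.left_commute mult_1)
qed

text \<open>The monomial contains x_1 or y_1, so its constant term is zero and
  \<open>mfps_one_minus_inverse\<close> applies.\<close>

lemma one_minus_XY_dvd_1:
  assumes "i > 0 \<or> j > 0"
  shows "(1 - Xprod i * Yprod j :: (xy_var, 'a::comm_ring_1) mfps) dvd 1"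
proof -
  have "xexp (XY_exponent i j) 1 \<noteq> 0 \<or> yexp (XY_exponent i j) 1 \<noteq> 0"
    using assms by auto
  then have "XY_exponent i j \<noteq> 0" by (metis lookup_zero)
  then have "mcoeff (Xprod i * Yprod j :: (xy_var, 'a) mfps) 0 = 0"
    by (simp add: Xprod_mult_Yprod mcoeff_mmonom)
  from mfps_one_minus_inverse[OF this] show ?thesis by (metis dvdI)
qed

lemma CP_11_0: "CP_11 0 = (1 :: (xy_var, 'a::comm_ring_1) mfps)"
proof -
  have "cp_exponents 0 = {0}"
    by (auto simp: cp_exponents_iff intro!: poly_mapping_eqI) (metis neq0_conv xy_var.exhaust)
  then show ?thesis
    by (intro mfps_eqI) (simp add: CP_11_eq_indicator_mfps mcoeff_indicator_mfps one_mfps.rep_eq)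
qed

lemma CP_11_Suc:
  "(CP_11 (Suc n) :: (xy_var, 'a::comm_ring_1) mfps) =
    CP_11 n * ((1 - Xprod n * Xprod (Suc n) * Yprod n * Yprod (Suc n)) /
      ((1 - Xprod (Suc n) * Yprod n) * (1 - Xprod n * Yprod (Suc n)) *
       (1 - Xprod (Suc n) * Yprod (Suc n))))"
proof -
  let ?D = "(1 - Xprod (Suc n) * Yprod n) * (1 - Xprod n * Yprod (Suc n)) *
    (1 - Xprod (Suc n) * Yprod (Suc n)) :: (xy_var, 'a) mfps"
  \<comment> \<open>Writing 1 as a triple product lets \<open>mult_dvd_mono\<close> treat the
    factors separately; each contains an index \<open>Suc n\<close>, hence is a unit even for n =
    0.\<close>
  have "?D dvd 1 * 1 * 1"
    by (intro mult_dvd_mono one_minus_XY_dvd_1) auto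
  with CP_11_Suc_mult[of n] have "CP_11 (Suc n) =
      (1 - Xprod (Suc n) * Yprod n * (Xprod n * Yprod (Suc n))) * CP_11 n / ?D"
    by (intro mfps_eq_divideI) simp_all
  then show ?thesis
    by (simp add: divide_mfps_def mult_ac)
qed

theorem theorem3p2:
  fixes n :: nat
  assumes "n \<ge> 1"
  shows "(CP_11 n :: (xy_var, 'a::comm_ring_1) mfps) =
    (\<Prod>i=1..n. (1 - Xprod (i - 1) * Xprod i * Yprod (i - 1) * Yprod i) /
       ((1 - Xprod i * Yprod (i - 1)) * (1 - Xprod (i - 1) * Yprod i) * (1 - Xprod i * Yprod i)))"
  by (induction n) (simp_all add: CP_11_0 CP_11_Suc)

end
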